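(* Let $\Sigma$ be a set of independence atoms. The following are equivalent: (1) for some pre-independence relation $\mathrel{\perp\!\!\!\perp}$ which is federated and admits an algebraic point, $\Sigma \models_{\mathrel{\perp\!\!\!\perp}} \vec{x} \perp \vec{y}$; (2) for any pre-independence relation $\mathrel{\perp\!\!\!\perp}$ which is federated and admits an algebraic point, $\Sigma \models_{\mathrel{\perp\!\!\!\perp}} \vec{x} \perp \vec{y}$; (3) $\Sigma \models^* \vec{x} \perp \vec{y}$; (4) $\Sigma \vdash \vec{x} \perp \vec{y}$.
   Context: Let $(\mathbf{K}, \preccurlyeq)$ be an AEC with amalgamation, joint embedding and arbitrarily large models, with monster model $\mathfrak{M}$. For a pre-independence relation $\mathrel{\perp\!\!\!\perp}$ on bounded subsets of $\mathfrak{M}$ (Invariance, Existence, Monotonicity, Base Monotonicity, Symmetry, Transitivity, Normality, Finite Character, Anti-Reflexivity), $\Sigma \models_{\mathrel{\perp\!\!\!\perp}} \vec{x} \perp \vec{y}$ means that every assignment $s$ into $\mathfrak{M}$ with $s(\vec{v}) \mathrel{\perp\!\!\!\perp}_\emptyset s(\vec{w})$ for all $\vec{v} \perp \vec{w} \in \Sigma$ also has $s(\vec{x}) \mathrel{\perp\!\!\!\perp}_\emptyset s(\vec{y})$; $\Sigma \models^* \vec{x} \perp \vec{y}$ means $\Sigma \models_{\mathrel{\perp\!\!\!\perp}} \vec{x} \perp \vec{y}$ for every pre-independence relation $\mathrel{\perp\!\!\!\perp}$ on $\mathfrak{M}$. $\vdash$ is derivability using: ($a_3$) $\vec{x} \perp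 \emptyset$; ($b_3$) $\vec{x} \perp \vec{y} \Rightarrow \vec{y} \perp \vec{x}$; ($c_3$) $\vec{x} \perp \vec{y}\vec{z} \Rightarrow \vec{x} \perp \vec{y}$; ($d_3$) $\vec{x} \perp \vec{y}$ and $\vec{x}\vec{y} \perp \vec{z} \Rightarrow \vec{x} \perp \vec{y}\vec{z}$; ($e_3$) $x \perp x \Rightarrow x \perp \vec{y}$; ($f_3$) permutations of either side; ($g_3$) $\vec{x} y \vec{z} \perp \vec{w} \Rightarrow \vec{x} y y \vec{z} \perp \vec{w}$. $\mathrel{\perp\!\!\!\perp}$ is federated if for every $n \ge 1$ there is an injective sequence $(a_i \mid i<n)$ with $(a_i \mid i<j) \mathrel{\perp\!\!\!\perp}_\emptyset a_j$ for all $j$ and some $d$ not $\mathrel{\perp\!\!\!\perp}_\emptyset$-independent from $a_0\cdots a_{n-1}$ but $d \mathrel{\perp\!\!\!\perp}_\emptyset (a_i \mid i<n)-a_j$ for each $j<n$; an algebraic point is $e$ with $e \mathrel{\perp\!\!\!\perp}_\emptyset e$.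
   Formalization: It is additionally assumed that the monster model carries at least one federated pre-independence relation admitting an algebraic point; otherwise (1) is false and (2) vacuously true (e.g. for infinite pure sets), so the equivalence fails. *)

theory Defs
  imports Main "HOL-Library.FuncSet" "HOL-Library.Multiset"
begin

unbundle cardinal_syntax

section \<open>Structures\<close>

record ('f, 'r) vocabulary =
  fun_syms :: "'f set"
  rel_syms :: "'r set"
  fun_arity :: "'f \<Rightarrow> nat"
  rel_arity :: "'r \<Rightarrow> nat"

record ('f, 'r, 'u) struct =
  univ :: "'u set"
  fun_int :: "'f \<Rightarrow> 'u list \<Rightarrow> 'u"
  rel_int :: "'r \<Rightarrow> 'u list set"

definition tuples :: "nat \<Rightarrow> 'u set \<Rightarrow> 'u list set" where
  "tuples n A = {xs. set xs \<subseteq> A \<and> length xs = n}"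

text \<open>Interpretations carry fixed values outside the universe and the vocabulary, so that
  structures that agree as mathematical objects are equal; antisymmetry of the strong
  substructure relation depends on this.\<close>

definition structure_on :: "('f, 'r) vocabulary \<Rightarrow> ('f, 'r, 'u) struct \<Rightarrow> bool" where
  "structure_on \<tau> M \<longleftrightarrow>
     univ M \<noteq> {} \<and>
     (\<forall>F \<in> fun_syms \<tau>. fun_int M F \<in> tuples (fun_arity \<tau> F) (univ M) \<rightarrow>\<^sub>E univ M) \<and>
     (\<forall>F. F \<notin> fun_syms \<tau> \<longrightarrow> fun_int M F = (\<lambda>_. undefined)) \<and>
     (\<forall>R \<in> rel_syms \<tau>. rel_int M R \<subseteq> tuples (rel_arity \<tau> R) (univ M)) \<and>
     (\<forall>R. R \<notin> rel_syms \<tau> \<longrightarrow> rel_int M R = {})"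

definition substructure ::
  "('f, 'r) vocabulary \<Rightarrow> ('f, 'r, 'u) struct \<Rightarrow> ('f, 'r, 'u) struct \<Rightarrow> bool" where
  "substructure \<tau> M N \<longleftrightarrow>
     structure_on \<tau> M \<and> structure_on \<tau> N \<and> univ M \<subseteq> univ N \<and>
     (\<forall>F \<in> fun_syms \<tau>. \<forall>xs \<in> tuples (fun_arity \<tau> F) (univ M). fun_int M F xs = fun_int N F xs) \<and>
     (\<forall>R \<in> rel_syms \<tau>. rel_int M R = rel_int N R \<inter> tuples (rel_arity \<tau> R) (univ M))"

definition isomorphism ::
  "('f, 'r) vocabulary \<Rightarrow> ('u \<Rightarrow> 'u) \<Rightarrow> ('f, 'r, 'u) struct \<Rightarrow> ('f, 'r, 'u) struct \<Rightarrow> bool" where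
  "isomorphism \<tau> f M N \<longleftrightarrow>
     structure_on \<tau> M \<and> structure_on \<tau> N \<and> bij_betw f (univ M) (univ N) \<and>
     (\<forall>F \<in> fun_syms \<tau>. \<forall>xs \<in> tuples (fun_arity \<tau> F) (univ M).
        f (fun_int M F xs) = fun_int N F (map f xs)) \<and>
     (\<forall>R \<in> rel_syms \<tau>. \<forall>xs \<in> tuples (rel_arity \<tau> R) (univ M).
        xs \<in> rel_int M R \<longleftrightarrow> map f xs \<in> rel_int N R)"

definition automorphism :: "('f, 'r) vocabulary \<Rightarrow> ('f, 'r, 'u) struct \<Rightarrow> ('u \<Rightarrow> 'u) \<Rightarrow> bool" where
  "automorphism \<tau> M f \<longleftrightarrow> isomorphism \<tau> f M M"


section \<open>Abstract elementary classes\<close>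

text \<open>The type \<open>'u\<close> plays the role of the set-theoretic universe: a class of structures is a
  set of structures whose universes are subsets of \<open>'u\<close>. The relation \<open>le\<close> is the strong
  substructure relation.\<close>

text \<open>Increasing continuous chains. Indexing by well-orders on \<open>'u\<close> loses nothing:
  a strictly increasing chain of subsets of \<open>'u\<close> cannot be longer.\<close>

definition continuous_chain ::
  "('f, 'r, 'u) struct set \<Rightarrow> (('f, 'r, 'u) struct \<Rightarrow> ('f, 'r, 'u) struct \<Rightarrow> bool)
    \<Rightarrow> 'u rel \<Rightarrow> ('u \<Rightarrow> ('f, 'r, 'u) struct) \<Rightarrow> bool" where
  "continuous_chain K le r Ms \<longleftrightarrow>
     Well_order r \<and> Field r \<noteq> {} \<and>
     (\<forall>i \<in> Field r. Ms i \<in> K) \<and>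
     (\<forall>i j. (i, j) \<in> r \<longrightarrow> le (Ms i) (Ms j)) \<and>
     (\<forall>i \<in> Field r.
        underS r i \<noteq> {} \<and> (\<forall>j \<in> underS r i. \<exists>k \<in> underS r i. j \<in> underS r k) \<longrightarrow>
        univ (Ms i) = (\<Union>j \<in> underS r i. univ (Ms j)))"

text \<open>The cardinality of \<open>X\<close> is an upper bound of the Loewenheim-Skolem number.\<close>

definition LS_bound ::
  "('f, 'r) vocabulary \<Rightarrow> ('f, 'r, 'u) struct set
    \<Rightarrow> (('f, 'r, 'u) struct \<Rightarrow> ('f, 'r, 'u) struct \<Rightarrow> bool) \<Rightarrow> 'u set \<Rightarrow> bool" where
  "LS_bound \<tau> K le X \<longleftrightarrow>
     infinite X \<and> |fun_syms \<tau>| \<le>o |X| \<and> |rel_syms \<tau>| \<le>o |X| \<and>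
     (\<forall>M \<in> K. \<forall>A \<subseteq> univ M. \<exists>N. le N M \<and> A \<subseteq> univ N \<and> |univ N| \<le>o |A| +c |X| )"

text \<open>In the chain axiom, the structure on the union of the chain is determined by the
  requirement that all members of the chain be substructures of it.\<close>

definition AEC ::
  "('f, 'r) vocabulary \<Rightarrow> ('f, 'r, 'u) struct set
    \<Rightarrow> (('f, 'r, 'u) struct \<Rightarrow> ('f, 'r, 'u) struct \<Rightarrow> bool) \<Rightarrow> bool" where
  "AEC \<tau> K le \<longleftrightarrow>
     (\<forall>M \<in> K. structure_on \<tau> M) \<and>
     (\<forall>M N. le M N \<longrightarrow> M \<in> K \<and> N \<in> K \<and> substructure \<tau> M N) \<and>
     (\<forall>M \<in> K. le M M) \<and>
     (\<forall>M N P. le M N \<and> le N P \<longrightarrow> le M P) \<and>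
     (\<forall>M N. le M N \<and> le N M \<longrightarrow> M = N) \<and>
     (\<forall>M N f. M \<in> K \<and> isomorphism \<tau> f M N \<longrightarrow> N \<in> K) \<and>
     (\<forall>M N M' N' f. le M N \<and> isomorphism \<tau> f N N' \<and> isomorphism \<tau> f M M' \<longrightarrow> le M' N') \<and>
     (\<forall>M N P. M \<in> K \<and> N \<in> K \<and> substructure \<tau> M N \<and> le N P \<and> le M P \<longrightarrow> le M N) \<and>
     (\<forall>r Ms. continuous_chain K le r Ms \<longrightarrow>
        (\<exists>N \<in> K. univ N = (\<Union>i \<in> Field r. univ (Ms i)) \<and>
           (\<forall>i \<in> Field r. le (Ms i) N) \<and>
           (\<forall>P. (\<forall>i \<in> Field r. le (Ms i) P) \<longrightarrow> le N P))) \<and>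
     (\<exists>X. LS_bound \<tau> K le X)"

definition K_embedding ::
  "('f, 'r) vocabulary \<Rightarrow> (('f, 'r, 'u) struct \<Rightarrow> ('f, 'r, 'u) struct \<Rightarrow> bool)
    \<Rightarrow> ('u \<Rightarrow> 'u) \<Rightarrow> ('f, 'r, 'u) struct \<Rightarrow> ('f, 'r, 'u) struct \<Rightarrow> bool" where
  "K_embedding \<tau> le f M N \<longleftrightarrow> (\<exists>M'. isomorphism \<tau> f M M' \<and> le M' N)"

definition amalgamation ::
  "('f, 'r) vocabulary \<Rightarrow> ('f, 'r, 'u) struct set
    \<Rightarrow> (('f, 'r, 'u) struct \<Rightarrow> ('f, 'r, 'u) struct \<Rightarrow> bool) \<Rightarrow> bool" where
  "amalgamation \<tau> K le \<longleftrightarrow>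
     (\<forall>M\<^sub>0 M\<^sub>1 M\<^sub>2. le M\<^sub>0 M\<^sub>1 \<and> le M\<^sub>0 M\<^sub>2 \<longrightarrow>
        (\<exists>N \<in> K. \<exists>f\<^sub>1 f\<^sub>2. K_embedding \<tau> le f\<^sub>1 M\<^sub>1 N \<and> K_embedding \<tau> le f\<^sub>2 M\<^sub>2 N \<and>
           (\<forall>x \<in> univ M\<^sub>0. f\<^sub>1 x = f\<^sub>2 x)))"

definition joint_embedding ::
  "('f, 'r) vocabulary \<Rightarrow> ('f, 'r, 'u) struct set
    \<Rightarrow> (('f, 'r, 'u) struct \<Rightarrow> ('f, 'r, 'u) struct \<Rightarrow> bool) \<Rightarrow> bool" where
  "joint_embedding \<tau> K le \<longleftrightarrow>
     (\<forall>M\<^sub>1 \<in> K. \<forall>M\<^sub>2 \<in> K. \<exists>N \<in> K. \<exists>f\<^sub>1 f\<^sub>2. K_embedding \<tau> le f\<^sub>1 M\<^sub>1 N \<and> K_embedding \<tau> le f\<^sub>2 M\<^sub>2 N)"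

definition arbitrarily_large_models :: "('f, 'r, 'u) struct set \<Rightarrow> bool" where
  "arbitrarily_large_models K \<longleftrightarrow> (\<forall>X :: 'u set. \<exists>M \<in> K. |X| \<le>o |univ M| )"

text \<open>A monster model is universal and strongly model-homogeneous for models of size less than
  a cardinal \<open>\<kappa>\<close> above the Loewenheim-Skolem number; bounded sets are those of size less than
  \<open>\<kappa>\<close>. Model-homogeneity in the form of extending embeddings of small models over small strong
  submodels follows from the two clauses.\<close>

definition monster_model ::
  "('f, 'r) vocabulary \<Rightarrow> ('f, 'r, 'u) struct set
    \<Rightarrow> (('f, 'r, 'u) struct \<Rightarrow> ('f, 'r, 'u) struct \<Rightarrow> bool) \<Rightarrow> 'k rel \<Rightarrow> ('f, 'r, 'u) struct \<Rightarrow> bool"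
  where
  "monster_model \<tau> K le \<kappa> \<MM> \<longleftrightarrow>
     \<MM> \<in> K \<and> Card_order \<kappa> \<and> (\<exists>X. LS_bound \<tau> K le X \<and> |X| <o \<kappa>) \<and>
     (\<forall>N \<in> K. |univ N| <o \<kappa> \<longrightarrow> (\<exists>f. K_embedding \<tau> le f N \<MM>)) \<and>
     (\<forall>N\<^sub>0 N\<^sub>1 f. le N\<^sub>0 \<MM> \<and> le N\<^sub>1 \<MM> \<and> |univ N\<^sub>0| <o \<kappa> \<and> isomorphism \<tau> f N\<^sub>0 N\<^sub>1 \<longrightarrow>
        (\<exists>g. automorphism \<tau> \<MM> g \<and> (\<forall>x \<in> univ N\<^sub>0. g x = f x)))"

definition bounded_in :: "'k rel \<Rightarrow> ('f, 'r, 'u) struct \<Rightarrow> 'u set \<Rightarrow> bool" where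
  "bounded_in \<kappa> \<MM> A \<longleftrightarrow> A \<subseteq> univ \<MM> \<and> |A| <o \<kappa>"


section \<open>Pre-independence relations\<close>

text \<open>\<open>ind A C B\<close> stands for: \<open>A\<close> is independent from \<open>B\<close> over \<open>C\<close>. Only its values on
  bounded sets matter. The clauses are, in order: Invariance, Existence, Monotonicity, Base
  Monotonicity, Symmetry, Transitivity, Normality, Finite Character, Anti-Reflexivity.\<close>

definition pre_independence ::
  "('f, 'r) vocabulary \<Rightarrow> 'k rel \<Rightarrow> ('f, 'r, 'u) struct
    \<Rightarrow> ('u set \<Rightarrow> 'u set \<Rightarrow> 'u set \<Rightarrow> bool) \<Rightarrow> bool" where
  "pre_independence \<tau> \<kappa> \<MM> ind \<longleftrightarrow>
    (let bd = bounded_in \<kappa> \<MM> in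
     (\<forall>A B C f. bd A \<and> bd B \<and> bd C \<and> automorphism \<tau> \<MM> f \<and> ind A C B \<longrightarrow>
        ind (f ` A) (f ` C) (f ` B)) \<and>
     (\<forall>A B. bd A \<and> bd B \<longrightarrow> ind A B B) \<and>
     (\<forall>A B C A' B'. bd A \<and> bd B \<and> bd C \<and> A' \<subseteq> A \<and> B' \<subseteq> B \<and> ind A C B \<longrightarrow> ind A' C B') \<and>
     (\<forall>A B C D. bd A \<and> bd B \<and> D \<subseteq> C \<and> C \<subseteq> B \<and> ind A D B \<longrightarrow> ind A C B) \<and>
     (\<forall>A B C. bd A \<and> bd B \<and> bd C \<and> ind A C B \<longrightarrow> ind B C A) \<and>
     (\<forall>A B C D. bd A \<and> bd B \<and> D \<subseteq> C \<and> C \<subseteq> B \<and> ind B C A \<and> ind C D A \<longrightarrow> ind B D A) \<and>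
     (\<forall>A B C. bd A \<and> bd B \<and> bd C \<and> ind A C B \<longrightarrow> ind (A \<union> C) C B) \<and>
     (\<forall>A B C. bd A \<and> bd B \<and> bd C \<and> (\<forall>A\<^sub>0 \<subseteq> A. finite A\<^sub>0 \<longrightarrow> ind A\<^sub>0 C B) \<longrightarrow> ind A C B) \<and>
     (\<forall>A B C. bd A \<and> bd B \<and> bd C \<and> ind A C A \<longrightarrow> ind A C B))"

definition federated ::
  "('f, 'r, 'u) struct \<Rightarrow> ('u set \<Rightarrow> 'u set \<Rightarrow> 'u set \<Rightarrow> bool) \<Rightarrow> bool" where
  "federated \<MM> ind \<longleftrightarrow>
     (\<forall>n \<ge> (1::nat). \<exists>a :: nat \<Rightarrow> 'u. a ` {..<n} \<subseteq> univ \<MM> \<and> inj_on a {..<n} \<and>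
        (\<forall>j < n. ind (a ` {..<j}) {} {a j}) \<and>
        (\<exists>d \<in> univ \<MM>. \<not> ind {d} {} (a ` {..<n}) \<and>
           (\<forall>j < n. ind {d} {} (a ` {..<n} - {a j}))))"

definition admits_algebraic_point ::
  "('f, 'r, 'u) struct \<Rightarrow> ('u set \<Rightarrow> 'u set \<Rightarrow> 'u set \<Rightarrow> bool) \<Rightarrow> bool" where
  "admits_algebraic_point \<MM> ind \<longleftrightarrow> (\<exists>e \<in> univ \<MM>. ind {e} {} {e})"


section \<open>Independence atoms\<close>

datatype 'v atom = Indep "'v list" "'v list"

fun satisfies :: "('u set \<Rightarrow> 'u set \<Rightarrow> 'u set \<Rightarrow> bool) \<Rightarrow> ('v \<Rightarrow> 'u) \<Rightarrow> 'v atom \<Rightarrow> bool" where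
  "satisfies ind s (Indep xs ys) \<longleftrightarrow> ind (s ` set xs) {} (s ` set ys)"

definition entails ::
  "('f, 'r, 'u) struct \<Rightarrow> ('u set \<Rightarrow> 'u set \<Rightarrow> 'u set \<Rightarrow> bool) \<Rightarrow> 'v atom set \<Rightarrow> 'v atom \<Rightarrow> bool" where
  "entails \<MM> ind \<Sigma> \<phi> \<longleftrightarrow>
     (\<forall>s. range s \<subseteq> univ \<MM> \<and> (\<forall>\<psi> \<in> \<Sigma>. satisfies ind s \<psi>) \<longrightarrow> satisfies ind s \<phi>)"

definition entails_star ::
  "('f, 'r) vocabulary \<Rightarrow> 'k rel \<Rightarrow> ('f, 'r, 'u) struct \<Rightarrow> 'v atom set \<Rightarrow> 'v atom \<Rightarrow> bool" where
  "entails_star \<tau> \<kappa> \<MM> \<Sigma> \<phi> \<longleftrightarrow> (\<forall>ind. pre_independence \<tau> \<kappa> \<MM> ind \<longrightarrow> entails \<MM> ind \<Sigma> \<phi>)"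

inductive derivable :: "'v atom set \<Rightarrow> 'v atom \<Rightarrow> bool" (infix \<open>\<turnstile>\<close> 50) for \<Sigma> where
  hyp: "\<phi> \<in> \<Sigma> \<Longrightarrow> \<Sigma> \<turnstile> \<phi>"
| a3: "\<Sigma> \<turnstile> Indep xs []"
| b3: "\<Sigma> \<turnstile> Indep xs ys \<Longrightarrow> \<Sigma> \<turnstile> Indep ys xs"
| c3: "\<Sigma> \<turnstile> Indep xs (ys @ zs) \<Longrightarrow> \<Sigma> \<turnstile> Indep xs ys"
| d3: "\<Sigma> \<turnstile> Indep xs ys \<Longrightarrow> \<Sigma> \<turnstile> Indep (xs @ ys) zs \<Longrightarrow> \<Sigma> \<turnstile> Indep xs (ys @ zs)"
| e3: "\<Sigma> \<turnstile> Indep [x] [x] \<Longrightarrow> \<Sigma> \<turnstile> Indep [x] ys"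
| f3: "\<Sigma> \<turnstile> Indep xs ys \<Longrightarrow> mset xs' = mset xs \<Longrightarrow> mset ys' = mset ys \<Longrightarrow> \<Sigma> \<turnstile> Indep xs' ys'"
| g3: "\<Sigma> \<turnstile> Indep (xs @ [y] @ zs) ws \<Longrightarrow> \<Sigma> \<turnstile> Indep (xs @ [y, y] @ zs) ws"

end

theory Submission
  imports Defs
begin

text \<open>
  Independence over the empty base and derivability from \<open>\<Sigma>\<close> obey the same calculus of finite
  sets, which gives soundness. For completeness, shrink an underivable atom to an underivable
  \<open>X \<perp> Y\<close> all of whose proper parts are derivable. Then no variable \<open>v\<close> of \<open>X\<close> or \<open>Y\<close> has
  \<open>v \<perp> v\<close> derivable. If \<open>X\<close> and \<open>Y\<close> share a variable, send it to a non-algebraic point and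
  everything else to the algebraic point. Otherwise use the federated witness for
  \<open>n = |X| + |Y| - 1\<close>: one variable goes to \<open>d\<close>, the others in \<open>X \<union> Y\<close> to the \<open>a\<^sub>i\<close>, and
  all remaining ones to the algebraic point. Every proper part of the witness is independent, so a
  derivable \<open>V \<perp> W\<close> can only fail if it partitions \<open>X \<union> Y\<close> into two nonempty pieces;
  but then minimality and exchange derive \<open>X \<perp> Y\<close>.
\<close>

section \<open>Independence calculus of finite sets\<close>

text \<open>The interface shared by variables (\<open>I\<close> is derivability, \<open>U\<close> is
  everything) and points of the monster model. By \<open>carrier\<close>, \<open>I\<close> fails
  outside finite subsets of \<open>U\<close>, so the other rules need side conditions only where new
  sets appear.\<close>

locale independence_calculus =
  fixes U :: "'a set" and I :: "'a set \<Rightarrow> 'a set \<Rightarrow> bool"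
  assumes empty: "finite A \<Longrightarrow> A \<subseteq> U \<Longrightarrow> I A {}"
    and sym: "I A B \<Longrightarrow> I B A"
    and mono: "I A B \<Longrightarrow> A' \<subseteq> A \<Longrightarrow> B' \<subseteq> B \<Longrightarrow> I A' B'"
    and exchange: "I A B \<Longrightarrow> I (A \<union> B) C \<Longrightarrow> I A (B \<union> C)"
    and algebraic: "I {x} {x} \<Longrightarrow> finite B \<Longrightarrow> B \<subseteq> U \<Longrightarrow> I {x} B"
    and carrier: "I A B \<Longrightarrow> finite A \<and> A \<subseteq> U"
begin

text \<open>An algebraic \<open>x\<close> is independent even from \<open>B \<union> A\<close>, so
  \<open>exchange\<close> can append it to \<open>A\<close>.\<close>

lemma insert_algebraic:
  assumes "I {x} {x}" "I A B"
  shows "I (insert x A) B"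
proof -
  have "I {x} (B \<union> A)"
    using assms algebraic carrier[of A B] carrier[of B A] sym[of A B] by auto
  then have "I B (A \<union> {x})" using assms exchange sym by blast
  then show ?thesis using sym by simp
qed

text \<open>Regroups a two-by-two partition: rows \<open>P, R\<close> and \<open>Q, S\<close> become
  columns \<open>P, Q\<close> and \<open>R, S\<close>. Exchange frees \<open>P\<close> from the
  other three cells and \<open>Q\<close> from \<open>R \<union> S\<close>; a last exchange joins
  \<open>Q\<close> and \<open>P\<close> on one side.\<close>

lemma exchange_crossing:
  assumes "I (P \<union> R) (Q \<union> S)" "I P R" "I Q S"
  shows "I (P \<union> Q) (R \<union> S)"
proof -
  have "I P (R \<union> (Q \<union> S))" using assms exchange by blast
  then have P: "I (R \<union> S \<union> Q) P" using sym by (simp add: Un_ac)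
  have "I Q (S \<union> (P \<union> R))" using assms exchange[of Q S "P \<union> R"] sym by (simp add: Un_ac)
  then have "I Q (R \<union> S)" by (rule mono) auto
  then have "I (R \<union> S) Q" by (rule sym)
  then have "I (R \<union> S) (Q \<union> P)" using P by (rule exchange)
  then show ?thesis using sym by (simp add: Un_ac)
qed

text \<open>Induction on the length: the last index lies on at most one side, and its point is
  independent from all earlier ones, so \<open>exchange\<close> adds it to that side.\<close>

lemma independent_sequence_image:
  assumes "a ` {..<n} \<subseteq> U" "\<forall>j<n. I (a ` {..<j}) {a j}"
    and "A \<inter> B = {}" "A \<union> B \<subseteq> {..<n::nat}"
  shows "I (a ` A) (a ` B)"
  using assms
proof (induction n arbitrary: A B)
  case 0
  then show ?case using empty by simp
next
  case (Suc n)
  have IH: "I (a ` A) (a ` B)" if "A \<inter> B = {}" "A \<union> B \<subseteq> {..<n}" for A B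
    using Suc.IH[OF _ _ that] Suc.prems(1,2) by (simp add: lessThan_Suc)
  \<comment> \<open>The sides are swapped in the conclusion because \<open>exchange\<close> enlarges
    the right-hand set.\<close>
  have step: "I (a ` B) (a ` A)" if "A \<inter> B = {}" "A \<union> B \<subseteq> {..<Suc n}" "n \<in> A" for A B
  proof -
    have sub: "B \<union> (A - {n}) \<subseteq> {..<n}" using that by (force simp: less_Suc_eq)
    have "I (a ` {..<n}) {a n}" using Suc.prems(2) by simp
    then have "I (a ` B \<union> a ` (A - {n})) {a n}" by (rule mono) (use sub in auto)
    moreover have "I (a ` B) (a ` (A - {n}))" by (rule IH) (use sub that(1) in auto)
    ultimately have "I (a ` B) (a ` (A - {n}) \<union> {a n})" using exchange by blast
    moreover have "a ` (A - {n}) \<union> {a n} = a ` A" using that(3) by auto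
    ultimately show ?thesis by simp
  qed
  consider "n \<in> A" | "n \<in> B" | "n \<notin> A \<union> B" by auto
  then show ?case
  proof cases
    case 1
    then show ?thesis using step[of A B] Suc.prems(3,4) sym by blast
  next
    case 2
    then show ?thesis using step[of B A] Suc.prems(3,4) by (simp add: Int_commute Un_commute)
  next
    case 3
    then have "A \<union> B \<subseteq> {..<n}" using Suc.prems(4) by (auto simp: less_Suc_eq)
    then show ?thesis using IH Suc.prems(3) by blast
  qed
qed

text \<open>Minimise the sum of the two cardinalities: shrinking either side strictly lowers
  it.\<close>

lemma minimal_dependent:
  assumes "finite X" "finite Y" "\<not> I X Y"
  obtains X' Y' where "X' \<subseteq> X" "Y' \<subseteq> Y" "\<not> I X' Y'"
    "\<And>P Q. P \<subseteq> X' \<Longrightarrow> Q \<subseteq> Y' \<Longrightarrow> P \<noteq> X' \<or> Q \<noteq> Y' \<Longrightarrow> I P Q"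
proof -
  let ?R = "\<lambda>(P, Q). P \<subseteq> X \<and> Q \<subseteq> Y \<and> \<not> I P Q" and ?m = "\<lambda>(P, Q). card P + card Q"
  obtain X' Y' where XY: "?R (X', Y')" and least: "\<And>P Q. ?R (P, Q) \<Longrightarrow> ?m (X', Y') \<le> ?m (P, Q)"
    using ex_has_least_nat[of ?R "(X, Y)" ?m] assms(3) by auto
  have fin: "finite X'" "finite Y'" using XY assms(1,2) finite_subset by auto
  show thesis
  proof (rule that[of X' Y'])
    show "X' \<subseteq> X" "Y' \<subseteq> Y" "\<not> I X' Y'" using XY by auto
    fix P Q
    assume PQ: "P \<subseteq> X'" "Q \<subseteq> Y'" "P \<noteq> X' \<or> Q \<noteq> Y'"
    have "card P \<le> card X'" "card Q \<le> card Y'" using PQ fin by (auto intro: card_mono)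
    moreover have "card P < card X' \<or> card Q < card Y'"
      using PQ fin by (auto intro: psubset_card_mono)
    ultimately have "?m (P, Q) < ?m (X', Y')" by simp linarith
    then have "\<not> ?R (P, Q)" using least[of P Q] by linarith
    then show "I P Q" using PQ XY by auto
  qed
qed

end

section \<open>Separating assignments from federated witnesses\<close>

text \<open>Deletion is by index \<open>j\<close> rather than by point \<open>a j\<close>, so that
  witnesses can be reindexed along a bijection. For injective \<open>a\<close> both deletions
  agree.\<close>

locale federated_calculus = independence_calculus +
  fixes e
  assumes algebraic_point: "I {e} {e}"
    and federated: "\<And>n::nat. 1 \<le> n \<Longrightarrow> \<exists>a d. a ` {..<n} \<subseteq> U \<and> d \<in> U \<and>
      (\<forall>j<n. I (a ` {..<j}) {a j}) \<and>
      \<not> I {d} (a ` {..<n}) \<and> (\<forall>j<n. I {d} (a ` ({..<n} - {j})))"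
begin

text \<open>Carries a witness of length \<open>card Z\<close> over to an index set of variables,
  with the order of the sequence forgotten.\<close>

lemma federated_image:
  fixes Z :: "'b set"
  assumes "finite Z" "Z \<noteq> {}"
  obtains b d where "b ` Z \<subseteq> U" "d \<in> U"
    "\<And>A B. A \<inter> B = {} \<Longrightarrow> A \<union> B \<subseteq> Z \<Longrightarrow> I (b ` A) (b ` B)"
    "\<not> I {d} (b ` Z)" "\<And>z. z \<in> Z \<Longrightarrow> I {d} (b ` (Z - {z}))"
proof -
  define n where "n = card Z"
  have "1 \<le> n" using assms by (simp add: n_def Suc_le_eq card_gt_0_iff)
  then obtain a d where a: "a ` {..<n} \<subseteq> U" "d \<in> U" "\<forall>j<n. I (a ` {..<j}) {a j}"
      "\<not> I {d} (a ` {..<n})" "\<forall>j<n. I {d} (a ` ({..<n} - {j}))"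
    using federated by blast
  obtain h where h: "bij_betw h Z {..<n}"
    using ex_bij_betw_finite_nat[OF assms(1)] by (auto simp: n_def atLeast0LessThan)
  then have inj: "inj_on h Z" and img: "h ` Z = {..<n}" by (auto simp: bij_betw_def)
  show thesis
  proof (rule that[of "a \<circ> h" d])
    have "(a \<circ> h) ` Z = a ` {..<n}" using img by (simp only: image_comp[symmetric])
    then show "(a \<circ> h) ` Z \<subseteq> U" "\<not> I {d} ((a \<circ> h) ` Z)"
      using a(1,4) by simp_all
    show "I ((a \<circ> h) ` A) ((a \<circ> h) ` B)" if "A \<inter> B = {}" "A \<union> B \<subseteq> Z" for A B
    proof -
      have "h ` A \<inter> h ` B = h ` (A \<inter> B)"
        using inj_on_image_Int[OF inj, of A B] that(2) by auto
      then have "h ` A \<inter> h ` B = {}" using that(1) by simp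
      moreover have "h ` A \<union> h ` B \<subseteq> {..<n}" using that(2) img by blast
      ultimately have "I (a ` h ` A) (a ` h ` B)"
        using independent_sequence_image[OF a(1,3)] by blast
      then show ?thesis by (simp add: image_comp)
    qed
    show "I {d} ((a \<circ> h) ` (Z - {z}))" if "z \<in> Z" for z
    proof -
      have "h ` (Z - {z}) = {..<n} - {h z}"
        using inj_on_image_set_diff[OF inj, of Z "{z}"] img that by simp
      moreover have "h z < n" using img that by blast
      ultimately show ?thesis using a(5) by (metis image_comp)
    qed
  qed (use a in auto)
qed

text \<open>Allows values equal to \<open>e\<close> to be ignored on both sides.\<close>

lemma independent_up_to_algebraic_point:
  assumes "I A B" "A' \<subseteq> insert e A" "B' \<subseteq> insert e B"
  shows "I A' B'"
proof -
  have "I (insert e B) (insert e A)"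
    using assms(1) insert_algebraic[OF algebraic_point] sym by blast
  then show ?thesis using assms(2,3) mono sym by blast
qed

text \<open>The countermodel: with \<open>D\<close> as derivability from a set of atoms,
  \<open>s\<close> satisfies every derivable atom and refutes the underivable one.\<close>

theorem separating_assignment:
  fixes D :: "'v set \<Rightarrow> 'v set \<Rightarrow> bool"
  assumes "independence_calculus UNIV D"
    and "finite X" "finite Y" "\<not> D X Y"
  obtains s where "range s \<subseteq> U" "\<And>V W. D V W \<Longrightarrow> I (s ` V) (s ` W)" "\<not> I (s ` X) (s ` Y)"
proof -
  interpret D: independence_calculus UNIV D by fact
  have e: "e \<in> U" using carrier[OF algebraic_point] by simp
  obtain X' Y' where sub: "X' \<subseteq> X" "Y' \<subseteq> Y" and dep: "\<not> D X' Y'"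
    and min: "\<And>P Q. P \<subseteq> X' \<Longrightarrow> Q \<subseteq> Y' \<Longrightarrow> P \<noteq> X' \<or> Q \<noteq> Y' \<Longrightarrow> D P Q"
    using D.minimal_dependent[OF assms(2-4)] by blast
  have fin: "finite X'" "finite Y'" using sub assms finite_subset by auto
  \<comment> \<open>Otherwise \<open>v\<close> could be deleted, making the pair hold by minimality,
    and then put back by \<open>insert_algebraic\<close>.\<close>
  have nonalg: "\<not> D {v} {v}" if "v \<in> X' \<union> Y'" for v
  proof
    assume v: "D {v} {v}"
    show False
    proof (cases "v \<in> X'")
      case True
      then have "D (X' - {v}) Y'" by (intro min) auto
      then have "D (insert v (X' - {v})) Y'" using v D.insert_algebraic by blast
      then show False using True dep by (simp add: insert_absorb)
    next
      case False
      then have "v \<in> Y'" using that by simp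
      then have "D X' (Y' - {v})" by (intro min) auto
      then have "D (insert v (Y' - {v})) X'" using v D.insert_algebraic D.sym by blast
      then show False using \<open>v \<in> Y'\<close> dep D.sym by (simp add: insert_absorb)
    qed
  qed
  have disjoint: "V \<inter> W \<inter> (X' \<union> Y') = {}" if "D V W" for V W
  proof (rule ccontr)
    assume "V \<inter> W \<inter> (X' \<union> Y') \<noteq> {}"
    then obtain v where v: "v \<in> V" "v \<in> W" "v \<in> X' \<union> Y'" by blast
    then have "D {v} {v}" using D.mono[OF that, of "{v}" "{v}"] by simp
    then show False using nonalg v(3) by blast
  qed
  show thesis
  proof (cases "X' \<inter> Y' = {}")
    case False
    then obtain v where v: "v \<in> X'" "v \<in> Y'" by blast
    obtain a :: "nat \<Rightarrow> 'a" and d where a: "a 0 \<in> U" "d \<in> U" "\<not> I {d} {a 0}"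
      using federated[of 1] by (auto simp: lessThan_Suc)
    \<comment> \<open>The case \<open>n = 1\<close> supplies a point with a dependence; were
      \<open>a 0\<close> independent from itself, \<open>algebraic\<close> would make it independent
      from \<open>d\<close>.\<close>
    have a0: "\<not> I {a 0} {a 0}" using a algebraic[of "a 0" "{d}"] sym by auto
    define s where "s u = (if u = v then a 0 else e)" for u
    show thesis
    proof (rule that[of s])
      show "range s \<subseteq> U" using a e by (auto simp: s_def)
      show "I (s ` V) (s ` W)" if "D V W" for V W
      proof -
        \<comment> \<open>At most one side contains the value \<open>a 0\<close>; up to
          \<open>e\<close> the other side is empty.\<close>
        have "v \<notin> V \<or> v \<notin> W" using disjoint[OF that] v by blast
        then show ?thesis
        proof
          assume "v \<notin> V"
          moreover have "I {} {a 0}" using a empty sym by simp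
          ultimately show ?thesis
            by (rule_tac independent_up_to_algebraic_point) (auto simp: s_def)
        next
          assume "v \<notin> W"
          moreover have "I {a 0} {}" using a empty by simp
          ultimately show ?thesis
            by (rule_tac independent_up_to_algebraic_point) (auto simp: s_def)
        qed
      qed
      show "\<not> I (s ` X) (s ` Y)"
      proof
        assume "I (s ` X) (s ` Y)"
        moreover have "s v = a 0" by (simp add: s_def)
        ultimately show False
          using a0 mono[of "s ` X" "s ` Y" "{a 0}" "{a 0}"] v sub
          by (metis empty_subsetI image_eqI in_mono insert_subset)
      qed
    qed
  next
    case True
    have ne: "X' \<noteq> {}" "Y' \<noteq> {}" using dep D.empty D.sym fin by auto
    then obtain x where x: "x \<in> X'" by blast
    \<comment> \<open>One variable \<open>x\<close> is held back to receive \<open>d\<close>. The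
      rest is nonempty since \<open>Y'\<close> is nonempty and disjoint from \<open>X'\<close>, so a
      witness of that length exists.\<close>
    define Z where "Z = X' \<union> Y' - {x}"
    have xZ: "x \<notin> Z" "X' \<union> Y' = insert x Z" using x by (auto simp: Z_def)
    have YZ: "Y' \<subseteq> Z" using True x by (auto simp: Z_def)
    have Z: "finite Z" "Z \<noteq> {}" using fin ne YZ by (auto simp: Z_def)
    obtain b d where b: "b ` Z \<subseteq> U" "d \<in> U"
      and indep: "\<And>A B. A \<inter> B = {} \<Longrightarrow> A \<union> B \<subseteq> Z \<Longrightarrow> I (b ` A) (b ` B)"
      and d: "\<not> I {d} (b ` Z)" "\<And>z. z \<in> Z \<Longrightarrow> I {d} (b ` (Z - {z}))"
      using federated_image[OF Z] by blast
    define s where "s u = (if u = x then d else if u \<in> Z then b u else e)" for u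
    have sZ: "s ` A = b ` A" if "A \<subseteq> Z" for A
      using that xZ by (auto simp: s_def image_iff)
    have sx: "s x = d" by (simp add: s_def)
    \<comment> \<open>A missing \<open>z\<close> makes \<open>d\<close> independent from all the
      remaining points, so \<open>exchange\<close> can append \<open>d\<close> to the images of
      \<open>A - {x}\<close>.\<close>
    have with_d: "I (s ` B) (s ` A)"
      if "A \<inter> B = {}" "A \<union> B \<subseteq> insert x Z" "x \<in> A" "z \<in> Z" "z \<notin> A \<union> B" for A B z
    proof -
      let ?A = "A - {x}"
      have AB: "?A \<inter> B = {}" "B \<union> ?A \<subseteq> Z - {z}" "?A \<subseteq> Z" "B \<subseteq> Z"
        using that by auto
      have "I {d} (b ` (B \<union> ?A))"
        using d(2)[OF that(4)] AB(2) by (rule_tac mono) auto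
      then have "I (b ` B \<union> b ` ?A) {d}" using sym by (simp add: image_Un)
      moreover have "I (b ` B) (b ` ?A)" using indep AB by blast
      ultimately have "I (b ` B) (b ` ?A \<union> {d})" using exchange by blast
      moreover have "s ` A = b ` ?A \<union> {d}"
        using sZ[OF AB(3)] sx that(3) by auto
      ultimately show ?thesis using sZ[OF AB(4)] by simp
    qed
    show thesis
    proof (rule that[of s])
      show "range s \<subseteq> U" using b e by (auto simp: s_def)
      show "I (s ` V) (s ` W)" if VW: "D V W" for V W
      proof -
        \<comment> \<open>Variables outside \<open>insert x Z\<close> have value \<open>e\<close>
          and are restored at the end.\<close>
        define V' W' where "V' = V \<inter> insert x Z" and "W' = W \<inter> insert x Z"
        have D': "D V' W'" using D.mono[OF VW] by (simp add: V'_def W'_def)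
        have disj: "V' \<inter> W' = {}" using disjoint[OF VW] xZ by (auto simp: V'_def W'_def)
        have in_T: "V' \<union> W' \<subseteq> insert x Z" by (auto simp: V'_def W'_def)
        have fin': "finite (s ` V')" "finite (s ` W')" "s ` V' \<subseteq> U" "s ` W' \<subseteq> U"
          using Z b e by (auto simp: V'_def W'_def s_def)
        have "I (s ` V') (s ` W')"
        proof (cases "V' = {} \<or> W' = {}")
          case True
          then show ?thesis using fin' empty sym by auto
        next
          case nonempty: False
          show ?thesis
          proof (cases "V' \<union> W' = insert x Z")
            case total: True
            \<comment> \<open>This case is contradictory. Since \<open>V'\<close> and
              \<open>W'\<close> are nonempty and disjoint, each cuts a proper part out of the
              minimal pair, and the parts are independent by \<open>min\<close>. Crossing the four
              cells then yields \<open>D X' Y'\<close>.\<close>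
            then have cover: "X' \<union> Y' = V' \<union> W'" using xZ by simp
            have "D (X' \<inter> V') (Y' \<inter> V')" "D (X' \<inter> W') (Y' \<inter> W')"
              using nonempty disj cover by (auto intro!: min)
            moreover have "D (X' \<inter> V' \<union> Y' \<inter> V') (X' \<inter> W' \<union> Y' \<inter> W')"
              using D' by (rule D.mono) auto
            ultimately have "D (X' \<inter> V' \<union> X' \<inter> W') (Y' \<inter> V' \<union> Y' \<inter> W')"
              using D.exchange_crossing by blast
            moreover have "X' \<inter> V' \<union> X' \<inter> W' = X'" "Y' \<inter> V' \<union> Y' \<inter> W' = Y'"
              using cover by auto
            ultimately show ?thesis using dep by simp
          next
            case False
            then obtain t where t: "t \<in> insert x Z" "t \<notin> V' \<union> W'" using in_T by blast
            show ?thesis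
            proof (cases "x \<in> V' \<union> W'")
              case True
              then have tZ: "t \<in> Z" using t by auto
              show ?thesis
              proof (cases "x \<in> V'")
                case True
                then show ?thesis using with_d[of V' W' t] disj in_T tZ t(2) sym by blast
              next
                case False
                then show ?thesis using with_d[of W' V' t] \<open>x \<in> V' \<union> W'\<close> disj in_T tZ t(2)
                  by blast
              qed
            next
              case False
              then have "V' \<subseteq> Z" "W' \<subseteq> Z" using in_T by auto
              then show ?thesis using indep[of V' W'] disj sZ by simp
            qed
          qed
        qed
        then show ?thesis
          by (rule independent_up_to_algebraic_point) (auto simp: V'_def W'_def s_def)
      qed
      show "\<not> I (s ` X) (s ` Y)"
      proof
        let ?A = "X' - {x}"
        have A: "?A \<subseteq> Z" by (auto simp: Z_def)
        obtain y where y: "y \<in> Y'" using ne by blast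
        assume "I (s ` X) (s ` Y)"
        then have "I (s ` X') (s ` Y')" using sub mono by (meson image_mono)
        moreover have "s ` X' = {d} \<union> b ` ?A" using sZ[OF A] sx x by auto
        ultimately have "I ({d} \<union> b ` ?A) (b ` Y')" using sZ[OF YZ] by simp
        \<comment> \<open>The point \<open>y\<close> of \<open>Y'\<close> is absent from
          \<open>?A\<close>, so only a proper part of the witness is involved; one exchange would
          then make \<open>d\<close> independent from all of it.\<close>
        moreover have "I {d} (b ` ?A)"
          using d(2)[of y] y YZ A True by (rule_tac mono[of "{d}" "b ` (Z - {y})"]) auto
        ultimately have "I {d} (b ` ?A \<union> b ` Y')" using exchange by blast
        moreover have "?A \<union> Y' = Z" using True x by (auto simp: Z_def)
        ultimately show False using d(1) by (simp add: image_Un[symmetric])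
      qed
    qed
  qed
qed

end

section \<open>Derivability as a calculus of finite sets\<close>

text \<open>Rules \<open>g3\<close> and \<open>f3\<close> copy the variables of \<open>xs'\<close>
  one by one to the front of \<open>xs\<close>; \<open>c3\<close>, applied after \<open>b3\<close>,
  then cuts off the original \<open>xs\<close>.\<close>

lemma derivable_subset_left:
  assumes "\<Sigma> \<turnstile> Indep xs ys" "set xs' \<subseteq> set xs"
  shows "\<Sigma> \<turnstile> Indep xs' ys"
proof -
  have "\<Sigma> \<turnstile> Indep (xs' @ xs) ys"
    using assms(2)
  proof (induction xs')
    case Nil
    then show ?case using assms(1) by simp
  next
    case (Cons x xs')
    then have "x \<in> set (xs' @ xs)" by auto
    then obtain us vs where uv: "xs' @ xs = us @ [x] @ vs" by (metis append_Cons append_Nil split_list)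
    moreover have "\<Sigma> \<turnstile> Indep (xs' @ xs) ys" using Cons by simp
    ultimately have "\<Sigma> \<turnstile> Indep (us @ [x, x] @ vs) ys" using derivable.g3 by metis
    moreover have "mset ((x # xs') @ xs) = mset (us @ [x, x] @ vs)"
      using arg_cong[OF uv, of mset] by simp
    ultimately show ?case using derivable.f3 by blast
  qed
  then show ?thesis using derivable.b3 derivable.c3 by blast
qed

lemma derivable_subset:
  assumes "\<Sigma> \<turnstile> Indep xs ys" "set xs' \<subseteq> set xs" "set ys' \<subseteq> set ys"
  shows "\<Sigma> \<turnstile> Indep xs' ys'"
  using assms derivable_subset_left derivable.b3 by metis

text \<open>Quantifying over enumerations builds in finiteness; by \<open>derivable_sets_iff\<close>
  the choice of enumeration is immaterial.\<close>

definition derivable_sets :: "'v atom set \<Rightarrow> 'v set \<Rightarrow> 'v set \<Rightarrow> bool" where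
  "derivable_sets \<Sigma> A B \<longleftrightarrow> (\<exists>xs ys. set xs = A \<and> set ys = B \<and> \<Sigma> \<turnstile> Indep xs ys)"

lemma derivable_sets_iff: "derivable_sets \<Sigma> (set xs) (set ys) \<longleftrightarrow> \<Sigma> \<turnstile> Indep xs ys"
  unfolding derivable_sets_def using derivable_subset by blast

lemma derivable_independence_calculus:
  fixes \<Sigma> :: "'v atom set"
  shows "independence_calculus UNIV (derivable_sets \<Sigma>)"
proof
  fix A B C A' B' :: "'v set" and x
  show "derivable_sets \<Sigma> A {}" if "finite A"
    using finite_list[OF that] derivable.a3 unfolding derivable_sets_def by fastforce
  show "derivable_sets \<Sigma> B A" if "derivable_sets \<Sigma> A B"
    using that derivable.b3 unfolding derivable_sets_def by blast
  show "derivable_sets \<Sigma> A' B'" if "derivable_sets \<Sigma> A B" and sub: "A' \<subseteq> A" "B' \<subseteq> B"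
  proof -
    obtain xs ys where xy: "set xs = A" "set ys = B" "\<Sigma> \<turnstile> Indep xs ys"
      using \<open>derivable_sets \<Sigma> A B\<close> unfolding derivable_sets_def by blast
    have "finite A'" "finite B'" using sub xy finite_subset by auto
    then obtain xs' ys' where "set xs' = A'" "set ys' = B'" using finite_list by metis
    then show ?thesis using derivable_subset[OF xy(3)] xy sub derivable_sets_iff by metis
  qed
  show "derivable_sets \<Sigma> A (B \<union> C)"
    if AB: "derivable_sets \<Sigma> A B" and ABC: "derivable_sets \<Sigma> (A \<union> B) C"
  proof -
    obtain xs ys where xy: "set xs = A" "set ys = B" "\<Sigma> \<turnstile> Indep xs ys"
      using AB unfolding derivable_sets_def by blast
    obtain zs where z: "set zs = C" using ABC unfolding derivable_sets_def by blast
    have "\<Sigma> \<turnstile> Indep (xs @ ys) zs"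
      using ABC xy z derivable_sets_iff[of \<Sigma> "xs @ ys" zs] by simp
    then have "\<Sigma> \<turnstile> Indep xs (ys @ zs)" using xy derivable.d3 by blast
    then show ?thesis using xy z derivable_sets_iff[of \<Sigma> xs "ys @ zs"] by simp
  qed
  show "derivable_sets \<Sigma> {x} B" if xx: "derivable_sets \<Sigma> {x} {x}" and "finite B"
  proof -
    obtain ys where ys: "set ys = B" using \<open>finite B\<close> finite_list by blast
    have "\<Sigma> \<turnstile> Indep [x] [x]" using xx derivable_sets_iff[of \<Sigma> "[x]" "[x]"] by simp
    then have "\<Sigma> \<turnstile> Indep [x] ys" by (rule derivable.e3)
    then show ?thesis using ys derivable_sets_iff[of \<Sigma> "[x]" ys] by simp
  qed
  show "finite A \<and> A \<subseteq> UNIV" if "derivable_sets \<Sigma> A B"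
    using that unfolding derivable_sets_def by auto
qed

section \<open>Pre-independence on finite sets over the empty base\<close>

text \<open>The cardinal \<kappa> lies above a Loewenheim-Skolem bound, which is infinite.\<close>

lemma finite_bounded_in:
  assumes "monster_model \<tau> K le \<kappa> \<MM>" "finite A" "A \<subseteq> univ \<MM>"
  shows "bounded_in \<kappa> \<MM> A"
proof -
  obtain X where "LS_bound \<tau> K le X" "|X| <o \<kappa>"
    using assms(1) unfolding monster_model_def by blast
  then have "|A| <o |X|"
    using assms(2) finite_ordLess_infinite[of "|A|" "|X|"]
    by (simp add: LS_bound_def card_of_well_order_on Field_card_of)
  then show ?thesis
    using assms(3) \<open>|X| <o \<kappa>\<close> ordLess_transitive unfolding bounded_in_def by blast
qed

definition fin_indep ::
  "('f, 'r, 'u) struct \<Rightarrow> ('u set \<Rightarrow> 'u set \<Rightarrow> 'u set \<Rightarrow> bool) \<Rightarrow> 'u set \<Rightarrow> 'u set \<Rightarrow> bool" where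
  "fin_indep \<MM> ind A B \<longleftrightarrow>
     finite A \<and> finite B \<and> A \<subseteq> univ \<MM> \<and> B \<subseteq> univ \<MM> \<and> ind A {} B"

lemma fin_indep_independence_calculus:
  assumes mm: "monster_model \<tau> K le \<kappa> \<MM>" and pre: "pre_independence \<tau> \<kappa> \<MM> ind"
  shows "independence_calculus (univ \<MM>) (fin_indep \<MM> ind)"
proof -
  let ?bd = "bounded_in \<kappa> \<MM>"
  have bd: "?bd A" if "finite A" "A \<subseteq> univ \<MM>" for A
    using finite_bounded_in[OF mm that] .
  have existence: "ind A B B" if "?bd A" "?bd B" for A B
    using pre that unfolding pre_independence_def Let_def by meson
  have monotonicity: "ind A' C B'"
    if "?bd A" "?bd B" "?bd C" "A' \<subseteq> A" "B' \<subseteq> B" "ind A C B" for A B C A' B'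
    using pre that unfolding pre_independence_def Let_def by meson
  have base_monotonicity: "ind A C B"
    if "?bd A" "?bd B" "D \<subseteq> C" "C \<subseteq> B" "ind A D B" for A B C D
    using pre that unfolding pre_independence_def Let_def by meson
  have symmetry: "ind B C A" if "?bd A" "?bd B" "?bd C" "ind A C B" for A B C
    using pre that unfolding pre_independence_def Let_def by meson
  have transitivity: "ind B D A"
    if "?bd A" "?bd B" "D \<subseteq> C" "C \<subseteq> B" "ind B C A" "ind C D A" for A B C D
    using pre that unfolding pre_independence_def Let_def by meson
  have normality: "ind (A \<union> C) C B" if "?bd A" "?bd B" "?bd C" "ind A C B" for A B C
    using pre that unfolding pre_independence_def Let_def by meson
  have anti_reflexivity: "ind A C B" if "?bd A" "?bd B" "?bd C" "ind A C A" for A B C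
    using pre that unfolding pre_independence_def Let_def by meson
  show ?thesis
  proof
    fix A B C A' B' x
    show "fin_indep \<MM> ind A {}" if "finite A" "A \<subseteq> univ \<MM>"
      using that existence[of A "{}"] bd by (simp add: fin_indep_def)
    show "fin_indep \<MM> ind B A" if "fin_indep \<MM> ind A B"
      using that symmetry[of A B "{}"] bd by (simp add: fin_indep_def)
    show "fin_indep \<MM> ind A' B'" if "fin_indep \<MM> ind A B" "A' \<subseteq> A" "B' \<subseteq> B"
      using that monotonicity[of A B "{}" A' B'] bd finite_subset[of A' A] finite_subset[of B' B]
      by (auto simp: fin_indep_def)
    show "fin_indep \<MM> ind A (B \<union> C)"
      if AB: "fin_indep \<MM> ind A B" and ABC: "fin_indep \<MM> ind (A \<union> B) C"
    proof -
      have b: "?bd A" "?bd B" "?bd C" "?bd (A \<union> B)" "?bd (B \<union> C)" "?bd (C \<union> B)" "?bd {}"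
        using AB ABC bd by (auto simp: fin_indep_def)
      \<comment> \<open>Exchange needs a detour over the base \<open>B\<close>: raise the base by
        base monotonicity, absorb it into the left side by normality, then return to the empty base
        by transitivity with \<open>B\<close> independent from \<open>A\<close>.\<close>
      have "ind C {} (A \<union> B)" using ABC symmetry[of "A \<union> B" C "{}"] b by (simp add: fin_indep_def)
      then have "ind C B (A \<union> B)" using base_monotonicity[of C "A \<union> B" "{}" B] b by simp
      then have "ind (C \<union> B) B (A \<union> B)" using normality[of C "A \<union> B" B] b by simp
      then have "ind (C \<union> B) B A"
        using monotonicity[of "C \<union> B" "A \<union> B" B "C \<union> B" A] b by simp
      moreover have "ind B {} A" using AB symmetry[of A B "{}"] b by (simp add: fin_indep_def)
      ultimately have "ind (C \<union> B) {} A" using transitivity[of A "C \<union> B" "{}" B] b by simp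
      then have "ind A {} (C \<union> B)" using symmetry[of "C \<union> B" A "{}"] b by simp
      then show ?thesis using AB ABC by (simp add: fin_indep_def Un_commute)
    qed
    show "fin_indep \<MM> ind {x} B"
      if "fin_indep \<MM> ind {x} {x}" "finite B" "B \<subseteq> univ \<MM>"
      using that anti_reflexivity[of "{x}" B "{}"] bd by (simp add: fin_indep_def)
    show "finite A \<and> A \<subseteq> univ \<MM>" if "fin_indep \<MM> ind A B"
      using that by (simp add: fin_indep_def)
  qed
qed

section \<open>Soundness, completeness and the equivalences\<close>

lemma satisfies_iff_fin_indep:
  assumes "range s \<subseteq> univ \<MM>"
  shows "satisfies ind s (Indep xs ys) \<longleftrightarrow> fin_indep \<MM> ind (s ` set xs) (s ` set ys)"
  using assms by (auto simp: fin_indep_def)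

text \<open>Satisfaction sees only the sets underlying the lists, which settles \<open>f3\<close>
  and \<open>g3\<close>; the other rules are those of the calculus.\<close>

lemma derivable_sound:
  fixes \<MM> :: "('f, 'r, 'u) struct" and \<Sigma> :: "'v atom set"
  assumes "monster_model \<tau> K le \<kappa> \<MM>" "pre_independence \<tau> \<kappa> \<MM> ind" "\<Sigma> \<turnstile> \<phi>"
  shows "entails \<MM> ind \<Sigma> \<phi>"
  unfolding entails_def
proof (intro allI impI, elim conjE)
  fix s :: "'v \<Rightarrow> 'u"
  assume s: "range s \<subseteq> univ \<MM>" and \<Sigma>: "\<forall>\<psi>\<in>\<Sigma>. satisfies ind s \<psi>"
  interpret independence_calculus "univ \<MM>" "fin_indep \<MM> ind"
    using fin_indep_independence_calculus[OF assms(1,2)] .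
  note iff = satisfies_iff_fin_indep[OF s]
  have fin: "finite (s ` set xs)" "s ` set xs \<subseteq> univ \<MM>" for xs using s by auto
  show "satisfies ind s \<phi>"
    using assms(3)
  proof induction
    case (hyp \<phi>)
    then show ?case using \<Sigma> by blast
  next
    case (a3 xs)
    then show ?case unfolding iff using empty[OF fin] by simp
  next
    case (b3 xs ys)
    then show ?case unfolding iff by (blast intro: sym)
  next
    case (c3 xs ys zs)
    from c3.IH show ?case unfolding iff by (rule mono) auto
  next
    case (d3 xs ys zs)
    then show ?case unfolding iff using exchange by (simp add: image_Un)
  next
    case (e3 x ys)
    then show ?case unfolding iff using algebraic[OF _ fin, of "s x" ys] by simp
  next
    case (f3 xs ys xs' ys')
    then show ?case by (metis satisfies.simps set_mset_mset)
  next
    case (g3 xs y zs ws)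
    then show ?case by simp
  qed
qed

text \<open>A single relation with the two properties already refutes every underivable
  atom.\<close>

lemma derivable_complete:
  assumes "monster_model \<tau> K le \<kappa> \<MM>" "pre_independence \<tau> \<kappa> \<MM> ind"
    and fed: "federated \<MM> ind" and "admits_algebraic_point \<MM> ind"
    and ent: "entails \<MM> ind \<Sigma> (Indep xs ys)"
  shows "\<Sigma> \<turnstile> Indep xs ys"
proof (rule ccontr)
  assume contra: "\<not> \<Sigma> \<turnstile> Indep xs ys"
  interpret independence_calculus "univ \<MM>" "fin_indep \<MM> ind"
    using fin_indep_independence_calculus[OF assms(1,2)] .
  obtain e where e: "e \<in> univ \<MM>" "ind {e} {} {e}"
    using assms(4) unfolding admits_algebraic_point_def by blast
  interpret federated_calculus "univ \<MM>" "fin_indep \<MM> ind" e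
  proof
    show "fin_indep \<MM> ind {e} {e}" using e by (simp add: fin_indep_def)
    fix n :: nat
    assume "1 \<le> n"
    then obtain a d where a: "a ` {..<n} \<subseteq> univ \<MM>" "inj_on a {..<n}"
        "\<forall>j<n. ind (a ` {..<j}) {} {a j}" "d \<in> univ \<MM>" "\<not> ind {d} {} (a ` {..<n})"
        "\<forall>j<n. ind {d} {} (a ` {..<n} - {a j})"
      using fed unfolding federated_def by blast
    \<comment> \<open>Injectivity of \<open>a\<close> turns deletion of the point \<open>a j\<close>
      into deletion of the index \<open>j\<close>.\<close>
    have minus: "a ` ({..<n} - {j}) = a ` {..<n} - {a j}" if "j < n" for j
      using inj_on_image_set_diff[OF a(2), of "{..<n}" "{j}"] that by simp
    have "fin_indep \<MM> ind (a ` {..<j}) {a j}" if "j < n" for j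
      using a(1,3) that by (auto simp: fin_indep_def)
    moreover have "fin_indep \<MM> ind {d} (a ` ({..<n} - {j}))" if "j < n" for j
      using a(1,4,6) that minus[OF that] by (auto simp: fin_indep_def)
    moreover have "\<not> fin_indep \<MM> ind {d} (a ` {..<n})" using a(5) by (simp add: fin_indep_def)
    ultimately show "\<exists>a d. a ` {..<n} \<subseteq> univ \<MM> \<and> d \<in> univ \<MM> \<and>
        (\<forall>j<n. fin_indep \<MM> ind (a ` {..<j}) {a j}) \<and>
        \<not> fin_indep \<MM> ind {d} (a ` {..<n}) \<and>
        (\<forall>j<n. fin_indep \<MM> ind {d} (a ` ({..<n} - {j})))"
      using a(1,4) by blast
  qed
  have "\<not> derivable_sets \<Sigma> (set xs) (set ys)" using contra derivable_sets_iff by blast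
  then obtain s where s: "range s \<subseteq> univ \<MM>"
    and sat: "\<And>V W. derivable_sets \<Sigma> V W \<Longrightarrow> fin_indep \<MM> ind (s ` V) (s ` W)"
    and nsat: "\<not> fin_indep \<MM> ind (s ` set xs) (s ` set ys)"
    using separating_assignment[OF derivable_independence_calculus, of "set xs" "set ys" \<Sigma>]
    by blast
  have "satisfies ind s \<psi>" if "\<psi> \<in> \<Sigma>" for \<psi>
  proof (cases \<psi>)
    case (Indep vs ws)
    then have "derivable_sets \<Sigma> (set vs) (set ws)"
      using that derivable.hyp derivable_sets_iff by blast
    then show ?thesis using sat Indep satisfies_iff_fin_indep[OF s] by blast
  qed
  then show False using ent s nsat satisfies_iff_fin_indep[OF s] unfolding entails_def by blast
qed

text \<open>Completeness takes (1) to (4), soundness takes (4) to (3), and (3) specialises to (2).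
  The step from (2) to (1) takes its relation from \<open>nonvacuous\<close>.\<close>

theorem theorem4p7:
  fixes \<tau> :: "('f, 'r) vocabulary"
    and K :: "('f, 'r, 'u) struct set"
    and le :: "('f, 'r, 'u) struct \<Rightarrow> ('f, 'r, 'u) struct \<Rightarrow> bool"
    and \<kappa> :: "'k rel"
    and \<MM> :: "('f, 'r, 'u) struct"
    and \<Sigma> :: "'v atom set"
    and xs ys :: "'v list"
  assumes "AEC \<tau> K le"
    and "amalgamation \<tau> K le"
    and "joint_embedding \<tau> K le"
    and "arbitrarily_large_models K"
    and "monster_model \<tau> K le \<kappa> \<MM>"
    and nonvacuous: "\<exists>ind. pre_independence \<tau> \<kappa> \<MM> ind \<and> federated \<MM> ind \<and>
                       admits_algebraic_point \<MM> ind"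
  shows "((\<exists>ind. pre_independence \<tau> \<kappa> \<MM> ind \<and> federated \<MM> ind \<and> admits_algebraic_point \<MM> ind \<and>
             entails \<MM> ind \<Sigma> (Indep xs ys))
          \<longleftrightarrow>
          (\<forall>ind. pre_independence \<tau> \<kappa> \<MM> ind \<and> federated \<MM> ind \<and> admits_algebraic_point \<MM> ind \<longrightarrow>
             entails \<MM> ind \<Sigma> (Indep xs ys))) \<and>
         ((\<forall>ind. pre_independence \<tau> \<kappa> \<MM> ind \<and> federated \<MM> ind \<and> admits_algebraic_point \<MM> ind \<longrightarrow>
             entails \<MM> ind \<Sigma> (Indep xs ys))
          \<longleftrightarrow> entails_star \<tau> \<kappa> \<MM> \<Sigma> (Indep xs ys)) \<and>
         (entails_star \<tau> \<kappa> \<MM> \<Sigma> (Indep xs ys) \<longleftrightarrow> \<Sigma> \<turnstile> Indep xs ys)"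
  using derivable_sound[OF assms(5)] derivable_complete[OF assms(5)] nonvacuous
  unfolding entails_star_def by blast

end
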